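(* $\mathbf{GR}^\circ$ enjoys uniform interpolation property: for every $\mathcal{L}_2$-formula $A$ and every finite set $P$ of propositional variables there is an $\mathcal{L}_2$-formula $C$ such that (1) $v(C)\subseteq v(A)\setminus P$; (2) $\mathbf{GR}^\circ\vdash A\to C$; (3) for every $\mathcal{L}_2$-formula $B$, if $\mathbf{GR}^\circ\vdash A\to B$ and $v(B)\cap P=\emptyset$, then $\mathbf{GR}^\circ\vdash C\to B$.
   Context: $\mathcal{L}_2$ is the bimodal propositional language with countably many propositional variables, $\bot$, connectives $\neg,\vee$ (others defined), and unary modal operators $\Box,\blacksquare$; $\Diamond$ abbreviates $\neg\Box\neg$; $v(A)$ denotes the set of propositional variables occurring in $A$. The logic $\mathbf{GR}^-$ has as axioms all propositional tautologies of $\mathcal{L}_2$ and all instances of $\Box(A\to B)\to(\Box A\to\Box B)$, $\Box(\Box A\to A)\to\Box A$, $\blacksquare A\to\Box A$, $\Box A\to\Box\blacksquare A$, $\Box A\to(\Box\bot\vee\blacksquare A)$, $\Diamond\blacksquare A\to\Diamond A$, and rules modus ponens and $\Box$-necessitation. $\mathbf{GR}^\circ$ is $\mathbf{GR}^-$ plus the rule: from $A$ infer $\blacksquare A$. *)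

theory Defs
  imports Main
begin

datatype fm =
    Var nat
  | Bot
  | Neg fm
  | Or fm fm
  | Box fm
  | BBox fm  (* the black box *)

abbreviation Imp :: "fm \<Rightarrow> fm \<Rightarrow> fm" (infixr "\<^bold>\<longrightarrow>" 55) where
  "A \<^bold>\<longrightarrow> B \<equiv> Or (Neg A) B"

abbreviation Dia :: "fm \<Rightarrow> fm" where
  "Dia A \<equiv> Neg (Box (Neg A))"

primrec vars :: "fm \<Rightarrow> nat set" where
  "vars (Var p) = {p}"
| "vars Bot = {}"
| "vars (Neg A) = vars A"
| "vars (Or A B) = vars A \<union> vars B"
| "vars (Box A) = vars A"
| "vars (BBox A) = vars A"

(* Boolean evaluation; v gives the truth values of the propositional variables and of the
   formulas beginning with a modal operator, which are all treated as independent atoms. *)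
primrec pl_eval :: "(fm \<Rightarrow> bool) \<Rightarrow> fm \<Rightarrow> bool" where
  "pl_eval v (Var p) = v (Var p)"
| "pl_eval v Bot = False"
| "pl_eval v (Neg A) = (\<not> pl_eval v A)"
| "pl_eval v (Or A B) = (pl_eval v A \<or> pl_eval v B)"
| "pl_eval v (Box A) = v (Box A)"
| "pl_eval v (BBox A) = v (BBox A)"

definition tautology :: "fm \<Rightarrow> bool" where
  "tautology A \<longleftrightarrow> (\<forall>v. pl_eval v A)"

inductive GR_axiom :: "fm \<Rightarrow> bool" where
  Taut: "tautology A \<Longrightarrow> GR_axiom A"
| Box_K: "GR_axiom (Box (A \<^bold>\<longrightarrow> B) \<^bold>\<longrightarrow> (Box A \<^bold>\<longrightarrow> Box B))"
| Box_L: "GR_axiom (Box (Box A \<^bold>\<longrightarrow> A) \<^bold>\<longrightarrow> Box A)"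
| BBox_Box: "GR_axiom (BBox A \<^bold>\<longrightarrow> Box A)"
| Box_BBox: "GR_axiom (Box A \<^bold>\<longrightarrow> Box (BBox A))"
| Box_Or: "GR_axiom (Box A \<^bold>\<longrightarrow> Or (Box Bot) (BBox A))"
| Dia_BBox: "GR_axiom (Dia (BBox A) \<^bold>\<longrightarrow> Dia A)"

inductive GR_minus :: "fm \<Rightarrow> bool" where
  Ax: "GR_axiom A \<Longrightarrow> GR_minus A"
| MP: "GR_minus (A \<^bold>\<longrightarrow> B) \<Longrightarrow> GR_minus A \<Longrightarrow> GR_minus B"
| Box_Nec: "GR_minus A \<Longrightarrow> GR_minus (Box A)"

inductive GR_circ :: "fm \<Rightarrow> bool" where
  Ax: "GR_axiom A \<Longrightarrow> GR_circ A"
| MP: "GR_circ (A \<^bold>\<longrightarrow> B) \<Longrightarrow> GR_circ A \<Longrightarrow> GR_circ B"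
| Box_Nec: "GR_circ A \<Longrightarrow> GR_circ (Box A)"
| BBox_Nec: "GR_circ A \<Longrightarrow> GR_circ (BBox A)"

end

theory Submission
  imports Defs
begin

text \<open>
  In a finite transitive tree, \<open>BBox D\<close> coincides with \<open>Box D\<close> at every inner node, while at a leaf it
  behaves like a fresh atom subject to finitely many constraints that are expressible with \<open>Box\<close>.
  Replacing \<open>BBox D\<close> by \<open>Box D\<close> at inner nodes therefore reduces derivability of \<open>A \<longrightarrow> B\<close> to validity
  in the provability logic GL of an implication whose antecedent (the translation of \<open>A\<close> and its
  constraints) and consequent only mention the atoms of \<open>A\<close> and of \<open>B\<close>, respectively. A uniform
  interpolant in GL, with \<open>BBox D\<close> read literally again, is then a uniform interpolant in the original logic.

  Uniform interpolation for GL is obtained by writing down, for each set \<open>t\<close> of subformulas, a formula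
  saying that some tree, equivalent up to the eliminated atoms, satisfies exactly \<open>t\<close>. This is a
  recursion on the set of boxed formulas in \<open>t\<close>, which can only grow along the tree. By the principle
  of Loeb, a false \<open>Box B\<close> can be refuted at a node with strictly more boxed formulas. The one
  remaining self-reference, through nodes with the same boxed formulas, is a fixed point equation
  \<open>x = D \<and> Box (E \<or> (L \<and> x))\<close>, which transitivity solves by \<open>x = D \<and> Box (E \<or> (L \<and> D))\<close>.
\<close>

section \<open>Propositional reasoning\<close>

abbreviation And :: "fm \<Rightarrow> fm \<Rightarrow> fm" where
  "And A B \<equiv> Neg (Or (Neg A) (Neg B))"

text \<open>The enumeration of \<open>S\<close> is an arbitrary choice. Only finite \<open>S\<close>
  are used, and truth values, variables and atoms do not depend on the order.\<close>

definition BigAnd :: "fm set \<Rightarrow> fm" where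
  "BigAnd S = foldr And (SOME xs. set xs = S) (Neg Bot)"

definition BigOr :: "fm set \<Rightarrow> fm" where
  "BigOr S = foldr Or (SOME xs. set xs = S) Bot"

lemma set_some_list: "finite S \<Longrightarrow> set (SOME xs. set xs = S) = S"
  by (rule someI_ex) (rule finite_list)

lemma pl_eval_BigAnd: "finite S \<Longrightarrow> pl_eval v (BigAnd S) \<longleftrightarrow> (\<forall>A\<in>S. pl_eval v A)"
proof -
  have "pl_eval v (foldr And xs (Neg Bot)) \<longleftrightarrow> (\<forall>A\<in>set xs. pl_eval v A)" for xs
    by (induction xs) auto
  then show "finite S \<Longrightarrow> ?thesis" by (simp add: BigAnd_def set_some_list)
qed

lemma vars_BigAnd: "finite S \<Longrightarrow> vars (BigAnd S) = (\<Union>A\<in>S. vars A)"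
proof -
  have "vars (foldr And xs (Neg Bot)) = (\<Union>A\<in>set xs. vars A)" for xs
    by (induction xs) auto
  then show "finite S \<Longrightarrow> ?thesis" by (simp add: BigAnd_def set_some_list)
qed

text \<open>Premises are discharged one by one by modus ponens until a tautology remains. The purely
  Boolean steps of later derivations go through this rule.\<close>

lemma GR_circ_pl_consequence:
  assumes "\<forall>A\<in>set As. GR_circ A" and "\<And>v. \<forall>A\<in>set As. pl_eval v A \<Longrightarrow> pl_eval v B"
  shows "GR_circ B"
  using assms
proof (induction As arbitrary: B)
  case Nil
  then show ?case by (auto intro!: GR_circ.Ax GR_axiom.Taut simp: tautology_def)
next
  case (Cons A As)
  have "GR_circ (A \<^bold>\<longrightarrow> B)" by (rule Cons.IH) (use Cons.prems in auto)
  then show ?case using Cons.prems(1) GR_circ.MP by auto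
qed

lemma GR_circ_Neg_And: "GR_circ (Neg B) \<Longrightarrow> GR_circ (Neg (And A B))"
  by (rule GR_circ_pl_consequence[of "[Neg B]"]) auto

lemma GR_circ_Box_mono: "GR_circ (A \<^bold>\<longrightarrow> B) \<Longrightarrow> GR_circ (Box A \<^bold>\<longrightarrow> Box B)"
  by (blast intro: GR_circ.intros GR_axiom.Box_K)

lemma GR_circ_Box_And: "GR_circ (Box A \<^bold>\<longrightarrow> Box B \<^bold>\<longrightarrow> Box (And A B))"
proof -
  have "GR_circ (A \<^bold>\<longrightarrow> B \<^bold>\<longrightarrow> And A B)"
    by (rule GR_circ_pl_consequence[of "[]"]) auto
  from GR_circ_Box_mono[OF this] show ?thesis
    by (intro GR_circ_pl_consequence[of "[Box A \<^bold>\<longrightarrow> Box (B \<^bold>\<longrightarrow> And A B),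
          Box (B \<^bold>\<longrightarrow> And A B) \<^bold>\<longrightarrow> (Box B \<^bold>\<longrightarrow> Box (And A B))]"])
      (auto intro: GR_circ.Ax GR_axiom.Box_K)
qed

lemma GR_circ_Box_BigAnd:
  assumes "finite S" and "\<And>A. A \<in> S \<Longrightarrow> GR_circ (F \<^bold>\<longrightarrow> Box A)"
  shows "GR_circ (F \<^bold>\<longrightarrow> Box (BigAnd S))"
proof -
  have "\<forall>A\<in>set xs. GR_circ (F \<^bold>\<longrightarrow> Box A) \<Longrightarrow> GR_circ (F \<^bold>\<longrightarrow> Box (foldr And xs (Neg Bot)))" for xs
  proof (induction xs)
    case Nil
    have "GR_circ (Neg Bot)" by (rule GR_circ_pl_consequence[of "[]"]) auto
    then show ?case
      by (intro GR_circ_pl_consequence[of "[Box (Neg Bot)]"]) (auto intro: GR_circ.Box_Nec)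
  next
    case (Cons A xs)
    let ?C = "foldr And xs (Neg Bot)"
    show ?case
      by (rule GR_circ_pl_consequence[of "[F \<^bold>\<longrightarrow> Box A, F \<^bold>\<longrightarrow> Box ?C, Box A \<^bold>\<longrightarrow> Box ?C \<^bold>\<longrightarrow> Box (And A ?C)]"])
        (use Cons GR_circ_Box_And in auto)
  qed
  then show ?thesis using assms by (simp add: BigAnd_def set_some_list)
qed

text \<open>The detour is through the black box: \<open>Box_BBox\<close> gives
  \<open>Box (BBox A)\<close>, and \<open>BBox_Box\<close> applies under the outer box.\<close>

lemma GR_circ_Box_trans: "GR_circ (Box A \<^bold>\<longrightarrow> Box (Box A))"
proof -
  have "GR_circ (Box (BBox A) \<^bold>\<longrightarrow> Box (Box A))"
    by (intro GR_circ_Box_mono GR_circ.Ax GR_axiom.BBox_Box)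
  then show ?thesis
    by (intro GR_circ_pl_consequence[of "[Box A \<^bold>\<longrightarrow> Box (BBox A), Box (BBox A) \<^bold>\<longrightarrow> Box (Box A)]"])
      (auto intro: GR_circ.Ax GR_axiom.Box_BBox)
qed


section \<open>Finite tree semantics\<close>

text \<open>Only elements of the form \<open>Var p\<close> or \<open>BBox D\<close> of a label are
  ever consulted, so a whole type may serve as a label.\<close>

datatype tree = Node (label: "fm set") "tree list"

text \<open>All proper descendants are listed, not only children: accessibility is then transitive
  and conversely well-founded, as in the models of GL.\<close>

fun desc :: "tree \<Rightarrow> tree list" where
  "desc (Node l ts) = concat (map (\<lambda>t. t # desc t) ts)"

text \<open>Formulas \<open>BBox D\<close> are treated as atoms here.\<close>

primrec sat :: "tree \<Rightarrow> fm \<Rightarrow> bool" where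
  "sat T (Var p) \<longleftrightarrow> Var p \<in> label T"
| "sat T Bot \<longleftrightarrow> False"
| "sat T (Neg A) \<longleftrightarrow> \<not> sat T A"
| "sat T (Or A B) \<longleftrightarrow> sat T A \<or> sat T B"
| "sat T (Box A) \<longleftrightarrow> (\<forall>U\<in>set (desc T). sat U A)"
| "sat T (BBox A) \<longleftrightarrow> BBox A \<in> label T"

primrec atoms :: "fm \<Rightarrow> fm set" where
  "atoms (Var p) = {Var p}"
| "atoms Bot = {}"
| "atoms (Neg A) = atoms A"
| "atoms (Or A B) = atoms A \<union> atoms B"
| "atoms (Box A) = atoms A"
| "atoms (BBox A) = {BBox A}"

primrec subs :: "fm \<Rightarrow> fm set" where
  "subs (Var p) = {Var p}"
| "subs Bot = {Bot}"
| "subs (Neg A) = insert (Neg A) (subs A)"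
| "subs (Or A B) = insert (Or A B) (subs A \<union> subs B)"
| "subs (Box A) = insert (Box A) (subs A)"
| "subs (BBox A) = {BBox A}"

lemma vars_atoms: "vars A = (\<Union>a\<in>atoms A. vars a)"
  by (induction A) auto

lemma sat_BigAnd: "finite S \<Longrightarrow> sat T (BigAnd S) \<longleftrightarrow> (\<forall>A\<in>S. sat T A)"
proof -
  have "sat T (foldr And xs (Neg Bot)) \<longleftrightarrow> (\<forall>A\<in>set xs. sat T A)" for xs
    by (induction xs) auto
  then show "finite S \<Longrightarrow> ?thesis" by (simp add: BigAnd_def set_some_list)
qed

lemma sat_BigOr: "finite S \<Longrightarrow> sat T (BigOr S) \<longleftrightarrow> (\<exists>A\<in>S. sat T A)"
proof -
  have "sat T (foldr Or xs Bot) \<longleftrightarrow> (\<exists>A\<in>set xs. sat T A)" for xs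
    by (induction xs) auto
  then show "finite S \<Longrightarrow> ?thesis" by (simp add: BigOr_def set_some_list)
qed

lemma atoms_BigAnd: "finite S \<Longrightarrow> atoms (BigAnd S) = (\<Union>A\<in>S. atoms A)"
proof -
  have "atoms (foldr And xs (Neg Bot)) = (\<Union>A\<in>set xs. atoms A)" for xs
    by (induction xs) auto
  then show "finite S \<Longrightarrow> ?thesis" by (simp add: BigAnd_def set_some_list)
qed

lemma atoms_BigOr: "finite S \<Longrightarrow> atoms (BigOr S) = (\<Union>A\<in>S. atoms A)"
proof -
  have "atoms (foldr Or xs Bot) = (\<Union>A\<in>set xs. atoms A)" for xs
    by (induction xs) auto
  then show "finite S \<Longrightarrow> ?thesis" by (simp add: BigOr_def set_some_list)
qed

lemma desc_trans: "U \<in> set (desc T) \<Longrightarrow> V \<in> set (desc U) \<Longrightarrow> V \<in> set (desc T)"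
  by (induction T rule: desc.induct) auto

lemma size_desc: "U \<in> set (desc T) \<Longrightarrow> size U < size T"
proof (induction T rule: desc.induct)
  case (1 l ts)
  then obtain t where t: "t \<in> set ts" "U = t \<or> U \<in> set (desc t)" by auto
  then have "size U \<le> size t" using 1(1) by fastforce
  moreover have "size t \<le> size_list size ts" using t(1) by (simp add: size_list_estimation')
  ultimately show ?case by simp
qed

lemma desc_induct [case_names desc]:
  assumes "\<And>T. (\<And>U. U \<in> set (desc T) \<Longrightarrow> Q U) \<Longrightarrow> Q T"
  shows "Q T"
  by (rule measure_induct_rule[of size]) (use assms size_desc in blast)

text \<open>The semantic form of Loeb's principle: in a finite tree, a failure of \<open>Q\<close>
  can be chosen deepest.\<close>

lemma desc_maximal_counterexample:
  assumes "U \<in> set (desc T)" "\<not> Q U"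
  shows "\<exists>V\<in>set (desc T). \<not> Q V \<and> (\<forall>W\<in>set (desc V). Q W)"
  using assms
proof (induction U rule: desc_induct)
  case (desc U)
  then show ?case using desc_trans by blast
qed


section \<open>Types\<close>

definition type_of :: "fm set \<Rightarrow> tree \<Rightarrow> fm set" where
  "type_of X T = {A \<in> X. sat T A}"

definition closed :: "fm set \<Rightarrow> bool" where
  "closed X \<longleftrightarrow> (\<forall>A. Neg A \<in> X \<longrightarrow> A \<in> X) \<and> (\<forall>A B. Or A B \<in> X \<longrightarrow> A \<in> X \<and> B \<in> X)
     \<and> (\<forall>A. Box A \<in> X \<longrightarrow> A \<in> X)"

text \<open>Boolean conditions only. Boxed formulas are governed by the types of the descendants,
  through \<open>succ_type\<close> and refuting witnesses.\<close>

definition coherent :: "fm set \<Rightarrow> fm set \<Rightarrow> bool" where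
  "coherent X t \<longleftrightarrow> t \<subseteq> X \<and> Bot \<notin> t \<and> (\<forall>A. Neg A \<in> X \<longrightarrow> (Neg A \<in> t \<longleftrightarrow> A \<notin> t))
     \<and> (\<forall>A B. Or A B \<in> X \<longrightarrow> (Or A B \<in> t \<longleftrightarrow> A \<in> t \<or> B \<in> t))"

definition boxes :: "fm set \<Rightarrow> fm set" where
  "boxes t = {A. Box A \<in> t}"

definition succ_type :: "fm set \<Rightarrow> fm set \<Rightarrow> bool" where
  "succ_type t t' \<longleftrightarrow> (\<forall>A\<in>boxes t. A \<in> t' \<and> A \<in> boxes t')"

definition atomic :: "fm \<Rightarrow> bool" where
  "atomic A \<longleftrightarrow> A \<in> range Var \<union> range BBox"

lemma closedD:
  assumes "closed X"
  shows "Neg A \<in> X \<Longrightarrow> A \<in> X" "Or A B \<in> X \<Longrightarrow> A \<in> X" "Or A B \<in> X \<Longrightarrow> B \<in> X" "Box A \<in> X \<Longrightarrow> A \<in> X"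
  using assms unfolding closed_def by blast+

lemma closed_subs: "closed (subs A)"
proof -
  have "B \<in> subs A \<Longrightarrow> subs B \<subseteq> subs A" for B by (induction A) auto
  moreover have "B \<in> subs B" for B by (cases B) auto
  ultimately show ?thesis unfolding closed_def by fastforce
qed

lemma self_subs: "A \<in> subs A"
  by (cases A) auto

lemma finite_subs: "finite (subs A)"
  by (induction A) auto

lemma atomic_subs: "atomic a \<Longrightarrow> a \<in> subs A \<Longrightarrow> a \<in> atoms A"
  by (induction A) (auto simp: atomic_def)

lemma atoms_atomic: "atomic a \<Longrightarrow> atoms a = {a}"
  by (auto simp: atomic_def)

lemma sat_atomic: "atomic a \<Longrightarrow> sat T a \<longleftrightarrow> a \<in> label T"
  by (auto simp: atomic_def)

lemma finite_boxes: "finite t \<Longrightarrow> finite (boxes t)"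
  unfolding boxes_def by (rule finite_imageD[of Box, OF finite_subset[of _ t]]) (auto simp: inj_on_def)

lemma coherent_type_of: "closed X \<Longrightarrow> coherent X (type_of X T)"
  by (auto simp: coherent_def type_of_def dest: closedD)

lemma succ_type_desc: "closed X \<Longrightarrow> U \<in> set (desc T) \<Longrightarrow> succ_type (type_of X T) (type_of X U)"
  by (auto simp: succ_type_def type_of_def boxes_def intro: desc_trans dest: closedD)

text \<open>The truth lemma for grafting trees below a new root. A box in \<open>t\<close> passes to
  each child together with its body, which takes care of all deeper nodes; a box outside
  \<open>t\<close> is refuted at a child.\<close>

lemma type_of_Node:
  assumes "closed X" "coherent X t"
    and l: "\<And>a. atomic a \<Longrightarrow> a \<in> X \<Longrightarrow> a \<in> l \<longleftrightarrow> a \<in> t"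
    and fwd: "\<And>U. U \<in> set ts \<Longrightarrow> succ_type t (type_of X U)"
    and wit: "\<And>A. A \<in> boxes X - boxes t \<Longrightarrow> \<exists>U\<in>set ts. A \<notin> type_of X U"
  shows "type_of X (Node l ts) = t"
proof -
  have "A \<in> X \<Longrightarrow> sat (Node l ts) A \<longleftrightarrow> A \<in> t" for A
  proof (induction A)
    case (Box A)
    then have A: "A \<in> X" using assms(1) closedD(4) by blast
    show ?case
    proof
      assume "Box A \<in> t"
      then have "sat U A \<and> sat U (Box A)" if "U \<in> set ts" for U
        using fwd[OF that] by (auto simp: succ_type_def boxes_def type_of_def)
      then show "sat (Node l ts) (Box A)" by auto
    next
      assume s: "sat (Node l ts) (Box A)"
      show "Box A \<in> t"
      proof (rule ccontr)
        assume "Box A \<notin> t"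
        then obtain U where "U \<in> set ts" "A \<notin> type_of X U"
          using wit[of A] Box.prems by (auto simp: boxes_def)
        then show False using s A by (auto simp: type_of_def)
      qed
    qed
  next
    case (Neg A)
    then have "A \<in> X" using assms(1) closedD(1) by blast
    then show ?case using Neg assms(2) by (simp add: coherent_def)
  next
    case (Or A B)
    then have "A \<in> X" "B \<in> X" using assms(1) closedD(2,3) by blast+
    then show ?case using Or assms(2) by (simp add: coherent_def)
  next
    case Bot
    show ?case using assms(2) by (simp add: coherent_def)
  qed (use l in \<open>auto simp: atomic_def\<close>)
  then show ?thesis using assms(2) by (auto simp: type_of_def coherent_def)
qed

text \<open>The measure for both recursions over types, in the model construction and in the
  construction of interpolants.\<close>

lemma boxes_decrease:
  assumes "finite X" "t \<subseteq> X" "t' \<subseteq> X" "boxes t \<subset> boxes t'"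
  shows "card (boxes X - boxes t') < card (boxes X - boxes t)"
proof (rule psubset_card_mono)
  show "finite (boxes X - boxes t)" using assms(1) by (simp add: finite_boxes)
  show "boxes X - boxes t' \<subset> boxes X - boxes t" using assms by (auto simp: boxes_def)
qed


section \<open>Completeness\<close>

definition state :: "fm set \<Rightarrow> fm set \<Rightarrow> fm" where
  "state X t = BigAnd ((\<lambda>A. if A \<in> t then A else Neg A) ` X)"

lemma pl_eval_state:
  "finite X \<Longrightarrow> pl_eval v (state X t) \<longleftrightarrow> (\<forall>A\<in>X. pl_eval v A \<longleftrightarrow> A \<in> t)"
  by (auto simp: state_def pl_eval_BigAnd ball_Un)

text \<open>The formulas of \<open>X\<close> are decided one at a time: if both decisions were
  refutable, so would be what was consistent before.\<close>

lemma Lindenbaum_state: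
  assumes "finite X" "\<not> GR_circ (Neg F)"
  shows "\<exists>t\<subseteq>X. \<not> GR_circ (Neg (And F (state X t)))"
  using assms
proof (induction X rule: finite_induct)
  case empty
  have "\<not> GR_circ (Neg (And F (state {} {})))"
    using empty GR_circ_pl_consequence[of "[Neg (And F (state {} {}))]" "Neg F"]
    by (auto simp: pl_eval_state)
  then show ?case by blast
next
  case (insert A X)
  then obtain t where t: "t \<subseteq> X" "\<not> GR_circ (Neg (And F (state X t)))" by blast
  let ?s = "\<lambda>t. Neg (And F (state (insert A X) t))"
  have "\<not> (GR_circ (?s t) \<and> GR_circ (?s (insert A t)))"
  proof
    assume "GR_circ (?s t) \<and> GR_circ (?s (insert A t))"
    then have "GR_circ (Neg (And F (state X t)))"
      using insert.hyps t(1)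
      by (intro GR_circ_pl_consequence[of "[?s t, ?s (insert A t)]"])
        (auto simp: pl_eval_state)
    then show False using t by blast
  qed
  then show ?case using t(1) by (meson insert_mono subset_insertI2)
qed

text \<open>If no such type existed, \<open>Box B\<close> would follow from \<open>B\<close>'s own
  provability under the boxes of \<open>t\<close>, and Loeb's axiom would force \<open>Box B\<close>
  into \<open>t\<close>. Having \<open>B\<close> in \<open>boxes t'\<close> makes the set of boxes
  grow strictly.\<close>

lemma consistent_succ_type:
  assumes X: "finite X" "closed X" and t: "t \<subseteq> X" "\<not> GR_circ (Neg (state X t))"
    and B: "B \<in> boxes X - boxes t"
  shows "\<exists>t'\<subseteq>X. \<not> GR_circ (Neg (state X t')) \<and> succ_type t t' \<and> B \<in> boxes t' \<and> B \<notin> t'"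
proof -
  have fin: "finite (boxes t)" using X t by (meson finite_boxes finite_subset)
  \<comment> \<open>\<open>D\<close> collects exactly what \<open>succ_type\<close> demands of a
    successor of \<open>t\<close>.\<close>
  define D where "D = BigAnd (boxes t \<union> Box ` boxes t)"
  have D: "pl_eval v D \<longleftrightarrow> (\<forall>A\<in>boxes t. pl_eval v A \<and> pl_eval v (Box A))" for v
    using fin by (auto simp: D_def pl_eval_BigAnd ball_Un)
  have BX: "Box B \<in> X" "Box B \<notin> t" using B by (auto simp: boxes_def)
  have "\<not> GR_circ (Neg (And D (And (Box B) (Neg B))))"
  proof
    assume "GR_circ (Neg (And D (And (Box B) (Neg B))))"
    then have "GR_circ (D \<^bold>\<longrightarrow> (Box B \<^bold>\<longrightarrow> B))"
      by (intro GR_circ_pl_consequence[of "[Neg (And D (And (Box B) (Neg B)))]"]) auto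
    from GR_circ_Box_mono[OF this] have 1: "GR_circ (Box D \<^bold>\<longrightarrow> Box (Box B \<^bold>\<longrightarrow> B))" .
    have st: "GR_circ (state X t \<^bold>\<longrightarrow> Box A)" if "A \<in> boxes t" for A
    proof -
      have "pl_eval v (Box A)" if "pl_eval v (state X t)" for v
        using that \<open>A \<in> boxes t\<close> t(1) pl_eval_state[OF X(1)] unfolding boxes_def by blast
      then show ?thesis by (intro GR_circ_pl_consequence[of "[]"]) auto
    qed
    have "GR_circ (state X t \<^bold>\<longrightarrow> Box (Box A))" if "A \<in> boxes t" for A
      by (rule GR_circ_pl_consequence[of "[state X t \<^bold>\<longrightarrow> Box A, Box A \<^bold>\<longrightarrow> Box (Box A)]"])
        (use st[OF that] GR_circ_Box_trans in auto)
    then have 2: "GR_circ (state X t \<^bold>\<longrightarrow> Box D)"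
      unfolding D_def using fin st by (intro GR_circ_Box_BigAnd) auto
    have 3: "GR_circ (Box (Box B \<^bold>\<longrightarrow> B) \<^bold>\<longrightarrow> Box B)"
      by (intro GR_circ.Ax GR_axiom.Box_L)
    have "\<not> pl_eval v (Box B)" if "pl_eval v (state X t)" for v
      using that BX pl_eval_state[OF X(1)] by blast
    then have "GR_circ (Neg (state X t))"
      using 1 2 3 by (intro GR_circ_pl_consequence[of "[Box D \<^bold>\<longrightarrow> Box (Box B \<^bold>\<longrightarrow> B),
            state X t \<^bold>\<longrightarrow> Box D, Box (Box B \<^bold>\<longrightarrow> B) \<^bold>\<longrightarrow> Box B]"]) auto
    then show False using t by blast
  qed
  from Lindenbaum_state[OF X(1) this] obtain t' where t':
    "t' \<subseteq> X" "\<not> GR_circ (Neg (And (And D (And (Box B) (Neg B))) (state X t')))" by blast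
  \<comment> \<open>A valuation satisfying the consistent conjunction agrees with \<open>t'\<close>
    on \<open>X\<close>, so membership in \<open>t'\<close> can be read off from it.\<close>
  have "\<exists>v. pl_eval v D \<and> pl_eval v (Box B) \<and> \<not> pl_eval v B \<and> pl_eval v (state X t')"
  proof (rule ccontr)
    assume "\<not> ?thesis"
    then have "GR_circ (Neg (And (And D (And (Box B) (Neg B))) (state X t')))"
      by (intro GR_circ_pl_consequence[of "[]"]) auto
    then show False using t' by blast
  qed
  then obtain v where v: "pl_eval v D" "pl_eval v (Box B)" "\<not> pl_eval v B" "pl_eval v (state X t')"
    by blast
  then have eq: "\<forall>A\<in>X. pl_eval v A \<longleftrightarrow> A \<in> t'" using pl_eval_state[OF X(1)] by blast
  have "\<not> GR_circ (Neg (state X t'))"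
    using t'(2) GR_circ_Neg_And by blast
  moreover have "succ_type t t'"
    using v(1) eq t(1) X(2) unfolding succ_type_def D boxes_def closed_def by blast
  moreover have "B \<in> boxes t'" "B \<notin> t'"
    using v(2,3) eq BX(1) X(2) unfolding boxes_def closed_def by blast+
  ultimately show ?thesis using t'(1) by blast
qed

lemma consistent_imp_coherent:
  assumes "finite X" "closed X" "t \<subseteq> X" "\<not> GR_circ (Neg (state X t))"
  shows "coherent X t"
proof -
  have "\<exists>v. pl_eval v (state X t)"
    using assms(4) GR_circ_pl_consequence[of "[]" "Neg (state X t)"] by auto
  then obtain v where "\<forall>A\<in>X. pl_eval v A \<longleftrightarrow> A \<in> t" using assms(1) pl_eval_state by blast
  then show ?thesis using assms(2,3) unfolding coherent_def closed_def
    by (metis pl_eval.simps(2-4) subsetD)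
qed

text \<open>One child is grafted for each box missing from \<open>t\<close>. Its type has strictly
  more boxes, so the recursion ends.\<close>

lemma consistent_realized:
  assumes "finite X" "closed X" "t \<subseteq> X" "\<not> GR_circ (Neg (state X t))"
  shows "\<exists>T. type_of X T = t"
  using assms
proof (induction "card (boxes X - boxes t)" arbitrary: t rule: less_induct)
  case less
  have "\<exists>U. succ_type t (type_of X U) \<and> B \<notin> type_of X U" if B: "B \<in> boxes X - boxes t" for B
  proof -
    obtain t' where t': "t' \<subseteq> X" "\<not> GR_circ (Neg (state X t'))" "succ_type t t'" "B \<in> boxes t'" "B \<notin> t'"
      using consistent_succ_type[OF less.prems B] by blast
    then have "boxes t \<subset> boxes t'" using B by (auto simp: succ_type_def)
    then obtain U where "type_of X U = t'"
      using less.hyps boxes_decrease less.prems t' by metis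
    then show ?thesis using t' by blast
  qed
  then obtain f where f: "\<And>B. B \<in> boxes X - boxes t \<Longrightarrow> succ_type t (type_of X (f B)) \<and> B \<notin> type_of X (f B)"
    by metis
  obtain ts where ts: "set ts = f ` (boxes X - boxes t)"
    using finite_list finite_boxes less.prems(1) by (metis finite_Diff finite_imageI)
  have "type_of X (Node t ts) = t"
    by (rule type_of_Node) (use less.prems f ts consistent_imp_coherent in auto)
  then show ?case by blast
qed

text \<open>Completeness of GL, with black-boxed formulas as atoms. The converse fails: instances of
  \<open>BBox_Box\<close> are derivable but not always valid under \<open>sat\<close>.\<close>

theorem tree_completeness:
  assumes "\<And>T. sat T A"
  shows "GR_circ A"
proof (rule ccontr)
  assume n: "\<not> GR_circ A"
  have "GR_circ (Neg (Neg A)) \<Longrightarrow> GR_circ A"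
    by (rule GR_circ_pl_consequence[of "[Neg (Neg A)]"]) auto
  with n Lindenbaum_state[OF finite_subs[of A], of "Neg A"] obtain t where t:
    "t \<subseteq> subs A" "\<not> GR_circ (Neg (And (Neg A) (state (subs A) t)))" by blast
  have "\<not> GR_circ (Neg (state (subs A) t))"
    using t(2) GR_circ_Neg_And by blast
  then obtain T where T: "type_of (subs A) T = t"
    using consistent_realized finite_subs closed_subs t(1) by blast
  have "A \<notin> t"
  proof
    assume "A \<in> t"
    then have "pl_eval v A" if "pl_eval v (state (subs A) t)" for v
      using that self_subs pl_eval_state[OF finite_subs] by blast
    then have "GR_circ (Neg (And (Neg A) (state (subs A) t)))"
      by (intro GR_circ_pl_consequence[of "[]"]) auto
    then show False using t by blast
  qed
  then show False using T assms self_subs by (auto simp: type_of_def)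
qed


section \<open>Uniform interpolation over trees\<close>

text \<open>The logical counterpart of bisimilarity up to the atoms in \<open>Q\<close>.\<close>

definition agree :: "fm set \<Rightarrow> tree \<Rightarrow> tree \<Rightarrow> bool" where
  "agree Q T U \<longleftrightarrow> (\<forall>A. atoms A \<inter> Q = {} \<longrightarrow> (sat T A \<longleftrightarrow> sat U A))"

text \<open>Children of the new root may match descendants of \<open>T\<close> at any depth. Nodes
  below the children are covered because agreement extends to \<open>Box A\<close>.\<close>

lemma agree_Node:
  assumes l: "\<And>a. a \<notin> Q \<Longrightarrow> a \<in> l \<longleftrightarrow> a \<in> label T"
    and fwd: "\<And>V. V \<in> set ts \<Longrightarrow> \<exists>U\<in>set (desc T). agree Q V U"
    and wit: "\<And>U. U \<in> set (desc T) \<Longrightarrow> \<exists>V\<in>set ts. agree Q V U"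
  shows "agree Q (Node l ts) T"
  unfolding agree_def
proof (intro allI impI)
  fix A
  show "atoms A \<inter> Q = {} \<Longrightarrow> sat (Node l ts) A \<longleftrightarrow> sat T A"
  proof (induction A)
    case (Box A)
    then have ag: "agree Q V U \<Longrightarrow> (sat V A \<longleftrightarrow> sat U A) \<and> (sat V (Box A) \<longleftrightarrow> sat U (Box A))" for V U
      unfolding agree_def by (metis atoms.simps(5))
    have "sat (Node l ts) (Box A) \<longleftrightarrow> (\<forall>V\<in>set ts. sat V A \<and> sat V (Box A))" by auto
    also have "\<dots> \<longleftrightarrow> (\<forall>U\<in>set (desc T). sat U A \<and> sat U (Box A))"
      using ag fwd wit by metis
    also have "\<dots> \<longleftrightarrow> sat T (Box A)" by (auto intro: desc_trans)
    finally show ?case .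
  qed (use l in auto)
qed

text \<open>Semantically, \<open>C\<close> is the existential quantification of the atoms in
  \<open>Q\<close> over the trees of type \<open>t\<close>, up to agreement outside
  \<open>Q\<close>.\<close>

lemma type_interpolant:
  assumes X: "finite X" "closed X" and "t \<subseteq> X"
  shows "\<exists>C. atoms C \<subseteq> {a \<in> X. atomic a} - Q
           \<and> (\<forall>T. type_of X T = t \<longrightarrow> sat T C)
           \<and> (\<forall>T. sat T C \<longrightarrow> (\<exists>T'. agree Q T' T \<and> type_of X T' = t))"
  using assms(3)
proof (induction "card (boxes X - boxes t)" arbitrary: t rule: less_induct)
  case less
  show ?case
  proof (cases "coherent X t")
    case False
    then have "type_of X T \<noteq> t" for T using coherent_type_of X by blast
    then show ?thesis by (intro exI[of _ Bot]) auto
  next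
    case True
    let ?Y = "{a \<in> X. atomic a} - Q"
    \<comment> \<open>Types in \<open>up\<close> have more boxes and fall under the induction
      hypothesis. Those in \<open>level\<close> have the same boxes and cause the
      self-reference.\<close>
    define up where "up = {t'. t' \<subseteq> X \<and> succ_type t t' \<and> boxes t \<subset> boxes t'}"
    define level where "level = {t'. coherent X t' \<and> succ_type t t' \<and> boxes t' = boxes t}"
    have finup: "finite up" unfolding up_def using X by simp
    have finlevel: "finite level" unfolding level_def coherent_def using X by simp
    have "\<forall>t'\<in>up. \<exists>C. atoms C \<subseteq> ?Y \<and> (\<forall>T. type_of X T = t' \<longrightarrow> sat T C)
           \<and> (\<forall>T. sat T C \<longrightarrow> (\<exists>T'. agree Q T' T \<and> type_of X T' = t'))"
      using less boxes_decrease[OF X(1)] by (auto simp: up_def)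
    then obtain f where fY: "\<And>t'. t' \<in> up \<Longrightarrow> atoms (f t') \<subseteq> ?Y"
      and f1: "\<And>T. type_of X T \<in> up \<Longrightarrow> sat T (f (type_of X T))"
      and f2: "\<And>t' T. t' \<in> up \<Longrightarrow> sat T (f t') \<Longrightarrow> \<exists>T'. agree Q T' T \<and> type_of X T' = t'"
      by metis

    have finY: "finite ?Y" using X(1) by simp
    define lit where "lit t' = BigAnd ((\<lambda>a. if a \<in> t' then a else Neg a) ` ?Y)" for t'
    have lit: "sat T (lit t') \<longleftrightarrow> (\<forall>a\<in>?Y. a \<in> label T \<longleftrightarrow> a \<in> t')" for T t'
    proof -
      have "sat T (lit t') \<longleftrightarrow> (\<forall>a\<in>?Y. sat T (if a \<in> t' then a else Neg a))"
        unfolding lit_def by (simp only: sat_BigAnd[OF finite_imageI[OF finY]] ball_simps)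
      also have "\<dots> \<longleftrightarrow> (\<forall>a\<in>?Y. a \<in> label T \<longleftrightarrow> a \<in> t')"
        by (intro ball_cong refl) (simp add: sat_atomic)
      finally show ?thesis .
    qed
    have litY: "atoms (lit t') \<subseteq> ?Y" for t'
      unfolding lit_def atoms_BigAnd[OF finite_imageI[OF finY]]
      by (intro UN_least) (auto simp: atoms_atomic simp del: if_image_distrib split: if_splits)

    \<comment> \<open>\<open>E\<close> says that a node can receive a type from \<open>up\<close>,
      and \<open>EB B\<close> that this type can refute \<open>B\<close>. \<open>D\<close> asks for
      a refutation of every missing box among the descendants, and \<open>L\<close> says that the
      retained atoms fit a type on the same level.\<close>
    define E where "E = BigOr (f ` up)"
    define EB where "EB B = BigOr (f ` {t' \<in> up. B \<notin> t'})" for B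
    define D where "D = BigAnd ((\<lambda>B. Dia (EB B)) ` (boxes X - boxes t))"
    define L where "L = BigOr (lit ` level)"
    \<comment> \<open>the solution of the fixed point equation \<open>R = And D (Box (Or E (And L R)))\<close>\<close>
    define R where "R = And D (Box (Or E (And L D)))"
    have finb: "finite (boxes X - boxes t)" using X by (simp add: finite_boxes)
    have satE: "sat T E \<longleftrightarrow> (\<exists>t'\<in>up. sat T (f t'))" for T
      using finup by (simp add: E_def sat_BigOr)
    have satEB: "sat T (EB B) \<longleftrightarrow> (\<exists>t'\<in>up. B \<notin> t' \<and> sat T (f t'))" for T B
      using finup by (auto simp: EB_def sat_BigOr)
    have satD: "sat T D \<longleftrightarrow> (\<forall>B\<in>boxes X - boxes t. \<exists>U\<in>set (desc T). sat U (EB B))" for T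
      using finb by (simp add: D_def sat_BigAnd)
    have satL: "sat T L \<longleftrightarrow> (\<exists>t'\<in>level. sat T (lit t'))" for T
      using finlevel by (simp add: L_def sat_BigOr)
    have "atoms E \<subseteq> ?Y" "\<And>B. atoms (EB B) \<subseteq> ?Y"
      using fY finup by (auto simp: E_def EB_def atoms_BigOr)
    moreover from this have "atoms D \<subseteq> ?Y"
      using finb by (auto simp: D_def atoms_BigAnd)
    moreover have "atoms L \<subseteq> ?Y"
      using litY finlevel by (auto simp: L_def atoms_BigOr)
    ultimately have RY: "atoms R \<subseteq> ?Y" by (auto simp: R_def)

    \<comment> \<open>At a deepest node where \<open>B\<close> fails, \<open>Box B\<close> holds, so
      the type there lies in \<open>up\<close>. Only the boxes of the type of \<open>T\<close>
      matter, hence \<open>D\<close> also holds at descendants on the same level.\<close>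
    have D_holds: "sat T D" if T: "boxes (type_of X T) = boxes t" for T
      unfolding satD
    proof
      fix B assume B: "B \<in> boxes X - boxes t"
      then have "\<not> sat T (Box B)" using T by (auto simp: boxes_def type_of_def)
      then obtain V where V: "V \<in> set (desc T)" "\<not> sat V B" "sat V (Box B)"
        using desc_maximal_counterexample[of _ T "\<lambda>U. sat U B"] by auto
      have "succ_type (type_of X T) (type_of X V)" using succ_type_desc X V by blast
      then have s: "succ_type t (type_of X V)" using T by (auto simp: succ_type_def)
      moreover have "B \<in> boxes (type_of X V)" using V B by (auto simp: type_of_def boxes_def)
      ultimately have "type_of X V \<in> up"
        using B by (auto simp: up_def succ_type_def type_of_def)
      moreover have "B \<notin> type_of X V" using V(2) by (simp add: type_of_def)
      ultimately have "sat V (EB B)" using f1 satEB by blast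
      then show "\<exists>U\<in>set (desc T). sat U (EB B)" using V by blast
    qed
    have R_holds: "sat T (And (lit t) R)" if T: "type_of X T = t" for T
    proof -
      have "sat U (Or E (And L D))" if U: "U \<in> set (desc T)" for U
      proof (cases "type_of X U \<in> up")
        case True
        then show ?thesis using f1 satE by auto
      next
        case False
        have s: "succ_type t (type_of X U)" using succ_type_desc[OF X(2) U] T by simp
        moreover from this have b: "boxes (type_of X U) = boxes t"
          using False by (auto simp: up_def succ_type_def type_of_def)
        ultimately have "type_of X U \<in> level"
          using coherent_type_of X by (auto simp: level_def)
        moreover have "sat U (lit (type_of X U))"
          by (auto simp: lit type_of_def sat_atomic)
        ultimately show ?thesis using D_holds[OF b] satL by auto
      qed
      moreover have "sat T (lit t)" using T by (auto simp: lit type_of_def sat_atomic)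
      ultimately show ?thesis using D_holds T by (auto simp: R_def)
    qed

    \<comment> \<open>The induction is on the tree, with \<open>t'\<close> varying, since a
      descendant may receive another type of the same level.\<close>
    have realize: "coherent X t' \<Longrightarrow> boxes t' = boxes t \<Longrightarrow> sat T (lit t') \<Longrightarrow> sat T R
        \<Longrightarrow> \<exists>T'. agree Q T' T \<and> type_of X T' = t'" for T t'
    proof (induction T arbitrary: t' rule: desc_induct)
      case (desc T)
      have "\<exists>V. agree Q V U \<and> succ_type t (type_of X V)" if U: "U \<in> set (desc T)" for U
      proof -
        have "sat U E \<or> sat U L \<and> sat U D" using desc.prems(4) U by (auto simp: R_def)
        then show ?thesis
        proof
          assume "sat U E"
          then show ?thesis using f2 satE by (metis (lifting) up_def mem_Collect_eq)
        next
          assume "sat U L \<and> sat U D"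
          \<comment> \<open>By transitivity the boxed part of \<open>R\<close> passes from
            \<open>T\<close> to \<open>U\<close>, so \<open>D\<close> at \<open>U\<close> is enough
            to restore \<open>R\<close> there.\<close>
          moreover from this have "sat U R" using desc.prems(4) U desc_trans by (auto simp: R_def)
          ultimately obtain t1 where "t1 \<in> level" "sat U (lit t1)" "sat U R" using satL by blast
          then show ?thesis using desc.IH[OF U, of t1] by (auto simp: level_def)
        qed
      qed
      then obtain g where g: "\<And>U. U \<in> set (desc T) \<Longrightarrow> agree Q (g U) U \<and> succ_type t (type_of X (g U))"
        by metis
      \<comment> \<open>The trees \<open>g U\<close> match every descendant but need not refute the
        missing boxes, so a separate tree is taken for each of these.\<close>
      have "\<exists>V. (\<exists>U\<in>set (desc T). agree Q V U) \<and> succ_type t (type_of X V) \<and> B \<notin> type_of X V"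
        if B: "B \<in> boxes X - boxes t" for B
      proof -
        have "sat T D" using desc.prems(4) by (simp add: R_def)
        then obtain U where U: "U \<in> set (desc T)" "sat U (EB B)" using B satD by blast
        then obtain t1 where "t1 \<in> up" "B \<notin> t1" "sat U (f t1)" using satEB by blast
        then show ?thesis using f2[of t1 U] U by (auto simp: up_def)
      qed
      then obtain h where h: "\<And>B. B \<in> boxes X - boxes t \<Longrightarrow>
          (\<exists>U\<in>set (desc T). agree Q (h B) U) \<and> succ_type t (type_of X (h B)) \<and> B \<notin> type_of X (h B)"
        by metis
      obtain ts where ts: "set ts = g ` set (desc T) \<union> h ` (boxes X - boxes t)"
        using finb finite_list by (metis finite_UnI finite_imageI finite_set)
      \<comment> \<open>The label realizes \<open>t'\<close> on the atoms of \<open>X\<close> and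
        copies \<open>T\<close> elsewhere. On atoms of \<open>X\<close> outside \<open>Q\<close> the
        two agree by \<open>lit t'\<close>.\<close>
      define l where "l = {a. if a \<in> X \<and> atomic a then a \<in> t' else a \<in> label T}"
      have succ: "succ_type t' u \<longleftrightarrow> succ_type t u" for u
        using desc.prems(2) by (simp add: succ_type_def)
      have "type_of X (Node l ts) = t'"
      proof (rule type_of_Node)
        show "succ_type t' (type_of X U)" if "U \<in> set ts" for U
          using that g h ts succ by auto
        show "\<exists>U\<in>set ts. A \<notin> type_of X U" if "A \<in> boxes X - boxes t'" for A
          using that h ts desc.prems(2) by auto
      qed (use X desc.prems in \<open>auto simp: l_def\<close>)
      moreover have "agree Q (Node l ts) T"
      proof (rule agree_Node)
        show "a \<in> l \<longleftrightarrow> a \<in> label T" if "a \<notin> Q" for a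
          using desc.prems(3) that by (auto simp: l_def lit)
        show "\<exists>U\<in>set (desc T). agree Q V U" if "V \<in> set ts" for V
          using that g h ts by auto
        show "\<exists>V\<in>set ts. agree Q V U" if "U \<in> set (desc T)" for U
          using that g ts by auto
      qed
      ultimately show ?case by blast
    qed
    show ?thesis
      using RY litY[of t] R_holds realize[OF True] by (intro exI[of _ "And (lit t) R"]) auto
  qed
qed

text \<open>The interpolant is the disjunction over all types containing \<open>A\<close>. A tree
  satisfying it agrees outside \<open>Q\<close> with a tree satisfying \<open>A\<close>, from which
  \<open>B\<close> is transferred.\<close>

theorem tree_uniform_interpolation:
  "\<exists>C. atoms C \<subseteq> atoms A - Q \<and> (\<forall>T. sat T A \<longrightarrow> sat T C)
    \<and> (\<forall>B. (\<forall>T. sat T A \<longrightarrow> sat T B) \<and> atoms B \<inter> Q = {} \<longrightarrow> (\<forall>T. sat T C \<longrightarrow> sat T B))"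
proof -
  let ?X = "subs A"
  have "\<forall>t\<in>Pow ?X. \<exists>C. atoms C \<subseteq> {a \<in> ?X. atomic a} - Q \<and> (\<forall>T. type_of ?X T = t \<longrightarrow> sat T C)
     \<and> (\<forall>T. sat T C \<longrightarrow> (\<exists>T'. agree Q T' T \<and> type_of ?X T' = t))"
    using type_interpolant[OF finite_subs closed_subs] by blast
  then obtain f where fY: "\<And>t. t \<in> Pow ?X \<Longrightarrow> atoms (f t) \<subseteq> {a \<in> ?X. atomic a} - Q"
    and f1: "\<And>T. type_of ?X T \<in> Pow ?X \<Longrightarrow> sat T (f (type_of ?X T))"
    and f2: "\<And>t T. t \<in> Pow ?X \<Longrightarrow> sat T (f t) \<Longrightarrow> \<exists>T'. agree Q T' T \<and> type_of ?X T' = t"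
    by metis
  let ?S = "{t \<in> Pow ?X. A \<in> t}"
  define C where "C = BigOr (f ` ?S)"
  have fin: "finite ?S" by (simp add: finite_subs)
  have satC: "sat T C \<longleftrightarrow> (\<exists>t\<in>?S. sat T (f t))" for T
    using fin by (simp add: C_def sat_BigOr)
  have "{a \<in> ?X. atomic a} \<subseteq> atoms A" using atomic_subs by blast
  then have "atoms C \<subseteq> atoms A - Q"
    using fY fin by (simp add: C_def atoms_BigOr) blast
  moreover have "sat T C" if "sat T A" for T
    using that f1[of T] self_subs unfolding satC by (intro bexI[of _ "type_of ?X T"]) (auto simp: type_of_def)
  moreover have "sat T B"
    if AB: "\<forall>T. sat T A \<longrightarrow> sat T B" and B: "atoms B \<inter> Q = {}" and "sat T C" for B T
  proof -
    obtain t where t: "t \<in> Pow ?X" "A \<in> t" "sat T (f t)" using \<open>sat T C\<close> satC by auto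
    then obtain T' where T': "agree Q T' T" "type_of ?X T' = t" using f2 by blast
    then have "sat T' B" using AB t by (auto simp: type_of_def)
    then show ?thesis using T' B by (auto simp: agree_def)
  qed
  ultimately show ?thesis by blast
qed


section \<open>The black box as an atom\<close>

text \<open>Unlike \<open>atoms\<close> and \<open>subs\<close>, this also looks inside black
  boxes.\<close>

primrec bboxed :: "fm \<Rightarrow> fm set" where
  "bboxed (Var p) = {}"
| "bboxed Bot = {}"
| "bboxed (Neg A) = bboxed A"
| "bboxed (Or A B) = bboxed A \<union> bboxed B"
| "bboxed (Box A) = bboxed A"
| "bboxed (BBox A) = insert A (bboxed A)"

text \<open>At a leaf, \<open>BBox D\<close> is read off the label when \<open>D \<in> S\<close>. Otherwise it is given the value of
  \<open>D\<close>, which satisfies all constraints that the axioms impose on it.\<close>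

primrec ev :: "fm set \<Rightarrow> fm \<Rightarrow> tree \<Rightarrow> bool" where
  "ev S (Var p) T \<longleftrightarrow> Var p \<in> label T"
| "ev S Bot T \<longleftrightarrow> False"
| "ev S (Neg A) T \<longleftrightarrow> \<not> ev S A T"
| "ev S (Or A B) T \<longleftrightarrow> ev S A T \<or> ev S B T"
| "ev S (Box A) T \<longleftrightarrow> (\<forall>U\<in>set (desc T). ev S A U)"
| "ev S (BBox A) T \<longleftrightarrow>
    (if desc T = [] then (if A \<in> S then BBox A \<in> label T else ev S A T)
     else (\<forall>U\<in>set (desc T). ev S A U))"

text \<open>The conjuncts are what \<open>Box_BBox\<close>, \<open>Dia_BBox\<close> and the rule
  \<open>BBox_Nec\<close> impose at leaves. At inner nodes \<open>BBox A\<close> is evaluated as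
  \<open>Box A\<close>.\<close>

definition good1 :: "fm set \<Rightarrow> fm \<Rightarrow> tree \<Rightarrow> bool" where
  "good1 S A T \<longleftrightarrow>
     ((\<forall>U\<in>set (desc T). ev S A U) \<longrightarrow> (\<forall>U\<in>set (desc T). desc U = [] \<longrightarrow> BBox A \<in> label U))
   \<and> ((\<forall>U\<in>set (desc T). \<not> ev S A U) \<longrightarrow> (\<forall>U\<in>set (desc T). desc U = [] \<longrightarrow> BBox A \<notin> label U))
   \<and> (GR_circ A \<longrightarrow> desc T = [] \<longrightarrow> BBox A \<in> label T)"

definition good :: "fm set \<Rightarrow> tree \<Rightarrow> bool" where
  "good S T \<longleftrightarrow> (\<forall>A\<in>S. good1 S A T \<and> (\<forall>U\<in>set (desc T). good1 S A U))"

lemma good_desc: "good S T \<Longrightarrow> U \<in> set (desc T) \<Longrightarrow> good S U"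
  by (auto simp: good_def intro: desc_trans)

lemma ev_pl_eval: "pl_eval (\<lambda>A. ev S A T) A \<longleftrightarrow> ev S A T"
  by (induction A) auto

lemma ev_cong: "bboxed A \<subseteq> S \<Longrightarrow> ev S A T \<longleftrightarrow> ev UNIV A T"
  by (induction A arbitrary: T) auto

text \<open>For \<open>Box_BBox\<close> and \<open>Dia_BBox\<close>, goodness settles the leaves if
  \<open>A\<close> is in \<open>S\<close>; otherwise \<open>BBox A\<close> has the value of
  \<open>A\<close> there. \<open>BBox_Box\<close> and \<open>Box_Or\<close> hold at leaves because
  every boxed formula does.\<close>

lemma ev_axiom:
  assumes "GR_axiom A" "good S T"
  shows "ev S A T"
  using assms(1)
proof cases
  case Taut
  then show ?thesis using ev_pl_eval tautology_def by metis
next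
  case (Box_L A)
  have "ev S A U" if "\<forall>V\<in>set (desc T). ev S (Box A \<^bold>\<longrightarrow> A) V" "U \<in> set (desc T)" for U
    using desc_maximal_counterexample[of U T "ev S A"] that by force
  then show ?thesis using Box_L by auto
next
  case (Box_BBox A)
  have "ev S (BBox A) U" if all: "\<forall>V\<in>set (desc T). ev S A V" and U: "U \<in> set (desc T)" for U
  proof (cases "desc U = []")
    case True
    then show ?thesis using all U assms(2) unfolding good_def good1_def by simp
  next
    case False
    then show ?thesis using all desc_trans[OF U] by simp
  qed
  then have "ev S (Box A) T \<Longrightarrow> ev S (Box (BBox A)) T" unfolding ev.simps(5) by blast
  then show ?thesis unfolding Box_BBox ev.simps(3,4) by blast
next
  case (Dia_BBox A)
  have "\<not> ev S (BBox A) U" if n: "\<forall>V\<in>set (desc T). \<not> ev S A V" and U: "U \<in> set (desc T)" for U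
  proof (cases "desc U = []")
    case True
    then show ?thesis using n U assms(2) unfolding good_def good1_def by simp
  next
    case False
    then obtain V where "V \<in> set (desc U)" by (cases "desc U") auto
    then show ?thesis using n desc_trans[OF U] False by (simp only: ev.simps if_False) blast
  qed
  then have "ev S (Box (Neg A)) T \<Longrightarrow> ev S (Box (Neg (BBox A))) T" unfolding ev.simps(3,5) by blast
  then show ?thesis unfolding Dia_BBox ev.simps(3,4) by blast
qed auto

text \<open>The black-box rule at a leaf uses the third conjunct of \<open>good1\<close> when
  \<open>A\<close> is in \<open>S\<close>, and the induction hypothesis otherwise.\<close>

lemma ev_sound: "GR_circ A \<Longrightarrow> good S T \<Longrightarrow> ev S A T"
proof (induction A arbitrary: T rule: GR_circ.induct)
  case (BBox_Nec A)
  then have "ev S A T" "\<forall>U\<in>set (desc T). ev S A U" using good_desc by blast+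
  moreover have "A \<in> S \<Longrightarrow> desc T = [] \<Longrightarrow> BBox A \<in> label T"
    using BBox_Nec.hyps BBox_Nec.prems unfolding good_def good1_def by blast
  ultimately show ?case by simp
next
  case (Box_Nec A)
  then show ?case using good_desc by simp
qed (simp_all add: ev_axiom)

section \<open>Translation of formulas and leaf constraints into GL\<close>

text \<open>\<open>Box Bot\<close> singles out the leaves. There \<open>BBox A\<close> is kept with
  \<open>A\<close> untranslated, so that its value is read off the label.\<close>

primrec star :: "fm \<Rightarrow> fm" where
  "star (Var p) = Var p"
| "star Bot = Bot"
| "star (Neg A) = Neg (star A)"
| "star (Or A B) = Or (star A) (star B)"
| "star (Box A) = Box (star A)"
| "star (BBox A) = Or (And (Neg (Box Bot)) (Box (star A))) (And (Box Bot) (BBox A))"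

text \<open>This is \<open>good1\<close> as a formula; whether \<open>A\<close> is derivable is
  decided outside the object language.\<close>

definition constr1 :: "fm \<Rightarrow> fm" where
  "constr1 A = And (Box (star A) \<^bold>\<longrightarrow> Box (Box Bot \<^bold>\<longrightarrow> BBox A))
     (And (Box (Neg (star A)) \<^bold>\<longrightarrow> Box (Box Bot \<^bold>\<longrightarrow> Neg (BBox A)))
       (if GR_circ A then Box Bot \<^bold>\<longrightarrow> BBox A else Neg Bot))"

definition constr :: "fm \<Rightarrow> fm" where
  "constr A = BigAnd ((\<lambda>D. And (constr1 D) (Box (constr1 D))) ` bboxed A)"

lemma sat_star: "sat T (star A) \<longleftrightarrow> ev UNIV A T"
  by (induction A arbitrary: T) (auto simp: neq_Nil_conv)

lemma finite_bboxed: "finite (bboxed A)"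
  by (induction A) auto

lemma bboxed_trans: "D \<in> bboxed A \<Longrightarrow> bboxed D \<subseteq> bboxed A"
  by (induction A) auto

lemma bboxed_vars: "D \<in> bboxed A \<Longrightarrow> vars D \<subseteq> vars A"
  by (induction A) auto

lemma sat_constr1:
  assumes "bboxed A \<subseteq> S"
  shows "sat T (constr1 A) \<longleftrightarrow> good1 S A T"
  by (auto simp: constr1_def good1_def sat_star ev_cong[OF assms])

lemma sat_constr:
  assumes "bboxed A \<subseteq> S"
  shows "sat T (constr A) \<longleftrightarrow> (\<forall>D\<in>bboxed A. good1 S D T \<and> (\<forall>U\<in>set (desc T). good1 S D U))"
proof -
  have "sat U (constr1 D) \<longleftrightarrow> good1 S D U" if "D \<in> bboxed A" for D U
    using sat_constr1 assms bboxed_trans that by blast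
  then show ?thesis by (simp add: constr_def sat_BigAnd finite_bboxed)
qed

text \<open>The constraints are separated: those for the black boxes of \<open>A\<close> join the
  antecedent, those for \<open>B\<close> the consequent. Together they make the tree good for both,
  so soundness applies.\<close>

lemma GR_circ_imp_valid:
  assumes "GR_circ (A \<^bold>\<longrightarrow> B)"
  shows "sat T (And (constr A) (star A)) \<Longrightarrow> sat T (constr B \<^bold>\<longrightarrow> star B)"
proof -
  let ?S = "bboxed A \<union> bboxed B"
  assume A: "sat T (And (constr A) (star A))"
  have "sat T (star B)" if "sat T (constr B)"
  proof -
    have "good ?S T" using that A sat_constr[of A ?S] sat_constr[of B ?S] by (auto simp: good_def)
    then have "ev ?S (A \<^bold>\<longrightarrow> B) T" using ev_sound assms by blast
    then show ?thesis using A by (auto simp: sat_star ev_cong[of A ?S] ev_cong[of B ?S])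
  qed
  then show ?thesis by simp
qed

section \<open>Derivability of the translation and its constraints\<close>

text \<open>For a black box, \<open>BBox_Box\<close> and \<open>Box_Or\<close> make
  \<open>BBox A\<close> and \<open>Box A\<close> equivalent under \<open>Neg (Box Bot)\<close>;
  under \<open>Box Bot\<close> the translation is \<open>BBox A\<close> itself.\<close>

lemma GR_circ_star: "GR_circ (A \<^bold>\<longrightarrow> star A) \<and> GR_circ (star A \<^bold>\<longrightarrow> A)"
proof (induction A)
  case (Neg A)
  then show ?case
    by (intro conjI; intro GR_circ_pl_consequence[of "[A \<^bold>\<longrightarrow> star A, star A \<^bold>\<longrightarrow> A]" "_ \<^bold>\<longrightarrow> _"]) auto
next
  case (Or A B)
  then show ?case
    by (intro conjI; intro GR_circ_pl_consequence[of "[A \<^bold>\<longrightarrow> star A, star A \<^bold>\<longrightarrow> A, B \<^bold>\<longrightarrow> star B, star B \<^bold>\<longrightarrow> B]"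
          "_ \<^bold>\<longrightarrow> _"]) auto
next
  case (Box A)
  then show ?case using GR_circ_Box_mono by simp
next
  case (BBox A)
  let ?L = "[Box A \<^bold>\<longrightarrow> Box (star A), Box (star A) \<^bold>\<longrightarrow> Box A, BBox A \<^bold>\<longrightarrow> Box A,
    Box A \<^bold>\<longrightarrow> Or (Box Bot) (BBox A)]"
  have "\<forall>F\<in>set ?L. GR_circ F"
    using BBox GR_circ_Box_mono GR_circ.Ax GR_axiom.BBox_Box GR_axiom.Box_Or by simp
  then show ?case by (intro conjI; intro GR_circ_pl_consequence[of ?L "_ \<^bold>\<longrightarrow> _"]) auto
qed (auto intro!: GR_circ.Ax GR_axiom.Taut simp: tautology_def)

text \<open>The conjuncts come from \<open>Box_BBox\<close>, \<open>Dia_BBox\<close> and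
  \<open>BBox_Nec\<close> in turn, with \<open>star A\<close> exchanged for \<open>A\<close> under
  \<open>Box\<close>.\<close>

lemma GR_circ_constr1: "GR_circ (constr1 A)"
proof -
  have S: "GR_circ (A \<^bold>\<longrightarrow> star A)" "GR_circ (star A \<^bold>\<longrightarrow> A)" using GR_circ_star by auto
  let ?L1 = "[Box (star A) \<^bold>\<longrightarrow> Box A, Box A \<^bold>\<longrightarrow> Box (BBox A), Box (BBox A) \<^bold>\<longrightarrow> Box (Box Bot \<^bold>\<longrightarrow> BBox A)]"
  let ?L2 = "[Box (Neg (star A)) \<^bold>\<longrightarrow> Box (Neg A), Dia (BBox A) \<^bold>\<longrightarrow> Dia A,
    Box (Neg (BBox A)) \<^bold>\<longrightarrow> Box (Box Bot \<^bold>\<longrightarrow> Neg (BBox A))]"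
  let ?G = "if GR_circ A then Box Bot \<^bold>\<longrightarrow> BBox A else Neg Bot"
  have "GR_circ (Neg (star A) \<^bold>\<longrightarrow> Neg A)"
    using S by (intro GR_circ_pl_consequence[of "[A \<^bold>\<longrightarrow> star A]"]) auto
  moreover have "GR_circ (F \<^bold>\<longrightarrow> Box Bot \<^bold>\<longrightarrow> F)" for F
    by (rule GR_circ_pl_consequence[of "[]"]) auto
  ultimately have "\<forall>F\<in>set (?L1 @ ?L2). GR_circ F"
    using S GR_circ_Box_mono GR_circ.Ax GR_axiom.Box_BBox GR_axiom.Dia_BBox by simp
  moreover have "GR_circ ?G"
  proof (cases "GR_circ A")
    case True
    then show ?thesis
      by (intro GR_circ_pl_consequence[of "[BBox A]"]) (auto intro: GR_circ.BBox_Nec)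
  next
    case False
    then show ?thesis by (intro GR_circ_pl_consequence[of "[]"]) auto
  qed
  ultimately show ?thesis unfolding constr1_def
    by (intro GR_circ_pl_consequence[of "?G # ?L1 @ ?L2"]) (auto simp del: if_split)
qed

lemma GR_circ_constr: "GR_circ (constr A)"
proof -
  obtain xs where xs: "set xs = (\<lambda>D. And (constr1 D) (Box (constr1 D))) ` bboxed A"
    using finite_list finite_bboxed by (metis finite_imageI)
  have "GR_circ (And (constr1 D) (Box (constr1 D)))" for D
    by (rule GR_circ_pl_consequence[of "[constr1 D, Box (constr1 D)]"])
      (auto intro: GR_circ_constr1 GR_circ.Box_Nec)
  then show ?thesis
    using xs by (intro GR_circ_pl_consequence[of xs]) (auto simp: constr_def pl_eval_BigAnd finite_bboxed)
qed

lemma vars_star: "vars (star A) = vars A"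
  by (induction A) auto

lemma vars_constr: "vars (constr A) \<subseteq> vars A"
proof -
  have "vars (constr1 D) \<subseteq> vars D" for D by (auto simp: constr1_def vars_star)
  then show ?thesis using bboxed_vars by (fastforce simp: constr_def vars_BigAnd finite_bboxed)
qed

theorem theorem6p6:
  fixes A :: fm and P :: "nat set"
  assumes "finite P"
  shows "\<exists>C. vars C \<subseteq> vars A - P
           \<and> GR_circ (A \<^bold>\<longrightarrow> C)
           \<and> (\<forall>B. GR_circ (A \<^bold>\<longrightarrow> B) \<and> vars B \<inter> P = {} \<longrightarrow> GR_circ (C \<^bold>\<longrightarrow> B))"
proof -
  let ?A = "And (constr A) (star A)"
  \<comment> \<open>An atom \<open>BBox D\<close> is eliminated as soon as \<open>D\<close> mentions
    a variable of \<open>P\<close>.\<close>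
  let ?Q = "{a. vars a \<inter> P \<noteq> {}}"
  obtain C where C: "atoms C \<subseteq> atoms ?A - ?Q" "\<And>T. sat T ?A \<Longrightarrow> sat T C"
    and C3: "\<And>B T. (\<forall>T. sat T ?A \<longrightarrow> sat T B) \<Longrightarrow> atoms B \<inter> ?Q = {} \<Longrightarrow> sat T C \<Longrightarrow> sat T B"
    using tree_uniform_interpolation[of ?A ?Q] by blast
  have "vars ?A \<subseteq> vars A" using vars_constr vars_star by auto
  then have "vars C \<subseteq> vars A - P"
    using C(1) unfolding vars_atoms[of C] vars_atoms[of ?A] by blast
  moreover have "GR_circ (A \<^bold>\<longrightarrow> C)"
  proof -
    have "GR_circ (?A \<^bold>\<longrightarrow> C)" by (rule tree_completeness) (use C(2) in auto)
    then show ?thesis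
      using GR_circ_constr[of A] GR_circ_star[of A]
      by (intro GR_circ_pl_consequence[of "[?A \<^bold>\<longrightarrow> C, constr A, A \<^bold>\<longrightarrow> star A]"]) auto
  qed
  moreover have "GR_circ (C \<^bold>\<longrightarrow> B)" if B: "GR_circ (A \<^bold>\<longrightarrow> B)" "vars B \<inter> P = {}" for B
  proof -
    let ?B = "constr B \<^bold>\<longrightarrow> star B"
    have "vars ?B \<inter> P = {}" using B(2) vars_constr vars_star by auto
    then have "atoms ?B \<inter> ?Q = {}" unfolding vars_atoms[of ?B] by blast
    then have "sat T ?B" if "sat T C" for T
      using C3 GR_circ_imp_valid[OF B(1)] that by blast
    then have "GR_circ (C \<^bold>\<longrightarrow> ?B)" by (intro tree_completeness) auto
    then show ?thesis
      using GR_circ_constr[of B] GR_circ_star[of B]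
      by (intro GR_circ_pl_consequence[of "[C \<^bold>\<longrightarrow> ?B, constr B, star B \<^bold>\<longrightarrow> B]"]) auto
  qed
  ultimately show ?thesis by blast
qed

end
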